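(* Let $n$ be a positive integer. If $n$ is even, then $$\left\lfloor \left(\sum_{k=n}^{\infty} \frac{(-1)^{k}}{J_{k}}\right)^{-1}\right\rfloor = 2^{n-1}-1.$$
   Context: The Jacobsthal numbers $(J_n)_{n\ge 0}$ are defined by $J_0=0$, $J_1=1$ and $J_{n+2}=J_{n+1}+2J_n$ for $n\ge 0$; the first terms are $0,1,1,3,5,11,21,43,85,\dots$. Here $\lfloor x\rfloor$ denotes the greatest integer not exceeding the real number $x$. *)

theory Defs
  imports "HOL-Analysis.Analysis"
begin

fun jacobsthal :: "nat \<Rightarrow> nat" where
  "jacobsthal 0 = 0"
| "jacobsthal (Suc 0) = 1"
| "jacobsthal (Suc (Suc n)) = jacobsthal (Suc n) + 2 * jacobsthal n"

end

theory Submission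
  imports Defs
begin

text \<open>
  Binet's formula gives \<open>3 * J k = 2 ^ k - (- 1) ^ k\<close>. Grouping the alternating series in pairs
  starting at an even index \<open>k\<close> and writing \<open>x = 2 ^ k\<close>, each pair is squeezed between telescoping
  differences,
  \<open>2 / x - 2 / (4 * x) < 1 / J k - 1 / J (k + 1) < 1 / (x / 2 - 1) - 1 / (4 * x / 2 - 1)\<close>,
  so the sum lies strictly between \<open>1 / 2 ^ (n - 1)\<close> and \<open>1 / (2 ^ (n - 1) - 1)\<close>.
\<close>

lemma jacobsthal_closed_form: "real (jacobsthal k) = (2 ^ k - (- 1) ^ k) / 3"
  by (induction k rule: jacobsthal.induct) (auto simp: field_simps)

text \<open>With \<open>x = 2 ^ k\<close> and \<open>k\<close> even, the closed form gives
  \<open>3 / (x - 1) = 1 / J k\<close> and \<open>3 / (2 * x + 1) = 1 / J (k + 1)\<close>. Over a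
  common denominator the gap becomes a single fraction that is visibly positive.\<close>

lemma pair_lower_bound:
  fixes x :: real
  assumes "x > 1"
  shows "2 / x - 2 / (4 * x) < 3 / (x - 1) - 3 / (2 * x + 1)"
proof -
  have "3 / (x - 1) - 3 / (2 * x + 1) - (2 / x - 2 / (4 * x))
      = (15 * x + 3) / (2 * x * (x - 1) * (2 * x + 1))"
    using assms by (simp add: divide_simps) algebra
  also have "\<dots> > 0"
    using assms by (intro divide_pos_pos mult_pos_pos) auto
  finally show ?thesis by simp
qed

lemma pair_upper_bound:
  fixes x :: real
  assumes "x > 2"
  shows "3 / (x - 1) - 3 / (2 * x + 1) < 1 / (x / 2 - 1) - 1 / (4 * x / 2 - 1)"
proof -
  have "1 / (x / 2 - 1) - 1 / (4 * x / 2 - 1) - (3 / (x - 1) - 3 / (2 * x + 1))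
      = 3 * (7 * x - 4) / ((x - 2) * (2 * x - 1) * (x - 1) * (2 * x + 1))"
    using assms by (simp add: divide_simps) algebra
  also have "\<dots> > 0"
    using assms by (intro divide_pos_pos mult_pos_pos) auto
  finally show ?thesis by simp
qed

text \<open>A convergent series of positive terms has a positive sum, so strictness survives the
  limit. The floor needs this: \<open>inverse S\<close> must stay strictly below
  \<open>2 ^ (n - 1)\<close>.\<close>

lemma sums_strict_mono:
  fixes f g :: "nat \<Rightarrow> real"
  assumes "f sums a" "g sums b" "\<And>m. f m < g m"
  shows "a < b"
proof -
  have "(\<lambda>m. g m - f m) sums (b - a)"
    using assms by (intro sums_diff)
  moreover from this have "0 < (\<Sum>m. g m - f m)"
    using assms(3) by (intro suminf_pos) (auto simp: sums_iff)
  ultimately show ?thesis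
    by (simp add: sums_iff)
qed

text \<open>Comparison with a geometric series: since \<open>2 ^ (n + k) \<ge> 2\<close>, half of it
  absorbs the sign term in the closed form, which leaves
  \<open>J (n + k) \<ge> 2 ^ (n + k) / 6 \<ge> 2 ^ k / 6\<close>.\<close>

lemma summable_alternating_inverse_jacobsthal:
  assumes "n > 0"
  shows "summable (\<lambda>k. (- 1) ^ (n + k) / real (jacobsthal (n + k)))"
proof (rule summable_comparison_test')
  show "summable (\<lambda>k. 6 * (1 / 2 :: real) ^ k)"
    by (intro summable_mult summable_geometric) auto
  fix k :: nat
  have "(2::real) \<le> 2 ^ (n + k)"
    using power_increasing[of 1 "n + k" "2::real"] assms by simp
  moreover have "(2::real) ^ k \<le> 2 ^ (n + k)"
    by (intro power_increasing) auto
  moreover have "(- 1 :: real) ^ (n + k) \<le> 1"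
    by (cases "even (n + k)") auto
  ultimately have "2 ^ k / 6 \<le> real (jacobsthal (n + k))"
    unfolding jacobsthal_closed_form by argo
  then have "1 / real (jacobsthal (n + k)) \<le> 1 / (2 ^ k / 6)"
    by (rule frac_le[OF _ order_refl, rotated 2]) auto
  then show "norm ((- 1) ^ (n + k) / real (jacobsthal (n + k))) \<le> 6 * (1 / 2) ^ k"
    by (simp add: norm_divide norm_power power_one_over)
qed

theorem theorem3p1:
  fixes n :: nat
  assumes "n > 0" and "even n"
  shows "\<lfloor>inverse (\<Sum>k. (-1) ^ (n + k) / real (jacobsthal (n + k)))\<rfloor> = (2 ^ (n - 1) - 1 :: int)"
proof -
  define f where "f k = (- 1) ^ (n + k) / real (jacobsthal (n + k))" for k
  define S where "S = (\<Sum>k. f k)"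
  \<comment> \<open>The power \<open>2 ^ (n + 2 * m)\<close> at the start of the \<open>m\<close>-th
    pair.\<close>
  define x :: "nat \<Rightarrow> real" where "x m = 2 ^ n * 4 ^ m" for m
  have "n \<ge> 2"
    using assms by presburger
  then have x0: "(4::real) \<le> 2 ^ n"
    using power_increasing[of 2 n "2::real"] by simp
  have x_ge: "x m \<ge> 4" for m
    using mult_mono[OF x0 one_le_power[of "4::real" m]] by (simp add: x_def)
  have x_Suc: "x (Suc m) = 4 * x m" for m
    by (simp add: x_def)
  have pairs: "(\<lambda>m. 3 / (x m - 1) - 3 / (2 * x m + 1)) sums S"
  proof -
    have "f sums S"
      unfolding S_def f_def
      using summable_alternating_inverse_jacobsthal[OF assms(1)] by (rule summable_sums)
    then have "(\<lambda>m. sum f {m * 2..<m * 2 + 2}) sums S"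
      by (rule sums_group) simp
    moreover have "sum f {m * 2..<m * 2 + 2} = 3 / (x m - 1) - 3 / (2 * x m + 1)" for m
    proof -
      have "{m * 2..<m * 2 + 2} = {m * 2, m * 2 + 1}"
        by auto
      moreover have "(2::real) ^ (n + m * 2) = x m"
        by (simp add: x_def power_add power_mult mult.commute[of m])
      \<comment> \<open>As \<open>n\<close> is even, each pair starts at an even index, so its signs
        are plus, then minus.\<close>
      ultimately show ?thesis
        using assms(2) by (simp add: f_def jacobsthal_closed_form)
    qed
    ultimately show ?thesis
      by simp
  qed
  have x_lim: "filterlim x at_top sequentially"
    unfolding x_def
    by (intro filterlim_tendsto_pos_mult_at_top[OF tendsto_const]
        filterlim_at_infinity_imp_filterlim_at_top filterlim_realpow_sequentially_gt1) auto
  \<comment> \<open>By \<open>x_Suc\<close>, these differences are the lower bounds of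
    \<open>pair_lower_bound\<close> at \<open>x m\<close>.\<close>
  have "(\<lambda>m. 2 / x m - 2 / x (Suc m)) sums (2 / x 0 - 0)"
    by (intro telescope_sums' tendsto_divide_0[OF tendsto_const]
        filterlim_mono[OF x_lim at_top_le_at_infinity order_refl])
  then have lower: "2 / x 0 < S"
    using sums_strict_mono[OF _ pairs] pair_lower_bound x_ge x_Suc
    by (smt (verit, best))
  have "filterlim (\<lambda>m. - 1 + x m * (1 / 2)) at_top sequentially"
    by (intro filterlim_tendsto_add_at_top[OF tendsto_const]
        filterlim_at_top_mult_tendsto_pos[OF tendsto_const] x_lim) auto
  then have y_lim: "filterlim (\<lambda>m. x m / 2 - 1) at_top sequentially"
    by simp
  have "(\<lambda>m. 1 / (x m / 2 - 1) - 1 / (x (Suc m) / 2 - 1)) sums (1 / (x 0 / 2 - 1) - 0)"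
    by (intro telescope_sums' tendsto_divide_0[OF tendsto_const]
        filterlim_mono[OF y_lim at_top_le_at_infinity order_refl])
  then have upper: "S < 1 / (x 0 / 2 - 1)"
    using sums_strict_mono[OF pairs] pair_upper_bound x_ge x_Suc
    by (smt (verit, best))
  have half: "x 0 / 2 = 2 ^ (n - 1)"
    using assms(1) by (simp add: x_def power_diff)
  have "0 < S"
    using lower x_ge[of 0] by (smt (verit) divide_pos_pos)
  \<comment> \<open>Taking reciprocals of \<open>lower\<close> and \<open>upper\<close> is safe
    because \<open>x 0 \<ge> 4\<close> makes \<open>x 0 / 2 - 1\<close> positive.\<close>
  then have "2 ^ (n - 1) - 1 < inverse S" "inverse S < 2 ^ (n - 1)"
    using lower upper x_ge[of 0] unfolding half[symmetric] by (auto simp: field_simps)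
  then have "\<lfloor>inverse S\<rfloor> = 2 ^ (n - 1) - 1"
    by (intro floor_unique) auto
  then show ?thesis
    by (simp add: S_def f_def)
qed

end
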